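(* For every integer $t\ge1$, the limit $\lim_{n\to\infty}W_t(n)^{1/n}$ exists and satisfies \[\lim_{n\to\infty}W_t(n)^{1/n}\ge(\sqrt t+1)^2.\]
   Context: $S_n$ is the set of permutations of $\{1,\dots,n\}$. The stack-sorting map $s$: given an input permutation, repeatedly: if the stack is empty or the next input entry is smaller than the top of the stack, push the next input entry; otherwise pop the top of the stack to the end of the output. $s(\pi)$ is the final output. A permutation $\pi$ is $t$-stack-sortable if the $t$-fold iterate $s^t(\pi)$ is increasing; $W_t(n)$ is the number of $t$-stack-sortable permutations in $S_n$. *)

theory Defs
  imports Complex_Main "HOL-Combinatorics.Multiset_Permutations"
begin

(* Permutations are lists in one-line notation.  In "stack_sort_run st xs" the head of st is
   the top of the stack, xs is the remaining input, and the value is the list of entries still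
   to be output, in order. *)
fun stack_sort_run :: "nat list \<Rightarrow> nat list \<Rightarrow> nat list" where
  "stack_sort_run [] [] = []"
| "stack_sort_run [] (x # xs) = stack_sort_run [x] xs"
| "stack_sort_run (y # st) (x # xs) =
     (if x < y then stack_sort_run (x # y # st) xs
      else y # stack_sort_run st (x # xs))"
| "stack_sort_run (y # st) [] = y # stack_sort_run st []"

definition stack_sort :: "nat list \<Rightarrow> nat list" where
  "stack_sort p = stack_sort_run [] p"

definition stack_sortable :: "nat \<Rightarrow> nat list \<Rightarrow> bool" where
  "stack_sortable t p \<longleftrightarrow> sorted_wrt (<) ((stack_sort ^^ t) p)"

definition num_stack_sortable :: "nat \<Rightarrow> nat \<Rightarrow> nat" where
  "num_stack_sortable t n = card {p \<in> permutations_of_set {1..n}. stack_sortable t p}"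

end

theory Submission
  imports Defs
begin

text \<open>One pass of the stack keeps a descending pair \<open>c, b\<close> in this order exactly if a
  larger entry stands between them. Hence a pass maps the permutations avoiding all patterns of
  length \<open>t + 3\<close> that end in \<open>t + 3, 1\<close> to those avoiding all patterns of length
  \<open>t + 2\<close> that end in \<open>t + 2, 1\<close>, and so the latter are \<open>t\<close>-stack-sortable.
  This class, studied by Kremer, is built by appending last entries; a permutation with
  \<open>q + 1\<close> available values has children with \<open>min (q + 1) (g + t) + 1\<close> available values
  for \<open>g = 0, \<dots>, q\<close>. Every growth rate below \<open>(sqrt t + 1)\<^sup>2\<close> is attained by a
  nonnegative subsolution of this recursion with finite support. The limit exists by Fekete's
  lemma: direct sums give supermultiplicativity, and the push-pop words give an exponential
  upper bound.\<close>

section \<open>Relative order of entries under stack sorting\<close>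

fun before :: "'a list \<Rightarrow> 'a \<Rightarrow> 'a \<Rightarrow> bool" where
  "before [] x y \<longleftrightarrow> False"
| "before (z # zs) x y \<longleftrightarrow> (z = x \<and> y \<in> set zs) \<or> before zs x y"

lemma before_append:
  "before (p @ q) x y \<longleftrightarrow> before p x y \<or> before q x y \<or> x \<in> set p \<and> y \<in> set q"
  by (induction p) auto

lemma before_in_set: "before p x y \<Longrightarrow> x \<in> set p \<and> y \<in> set p"
  by (induction p) auto

lemma before_map:
  "before (map f p) x y \<longleftrightarrow> (\<exists>x' y'. x = f x' \<and> y = f y' \<and> before p x' y')"
  by (induction p) auto

lemma before_rev: "before (rev p) x y \<longleftrightarrow> before p y x"
  by (induction p) (auto simp: before_append)

lemma sorted_wrt_before: "sorted_wrt P p \<longleftrightarrow> (\<forall>x y. before p x y \<longrightarrow> P x y)"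
  by (induction p) auto

lemma before_antisym: "distinct p \<Longrightarrow> before p x y \<Longrightarrow> \<not> before p y x"
  by (induction p) (auto dest: before_in_set)

lemma before_trans: "distinct p \<Longrightarrow> before p x y \<Longrightarrow> before p y z \<Longrightarrow> before p x z"
  by (induction p) (auto dest: before_in_set)

lemma before_total:
  "x \<in> set p \<Longrightarrow> y \<in> set p \<Longrightarrow> x \<noteq> y \<Longrightarrow> before p x y \<or> before p y x"
  by (induction p) auto

lemma mset_stack_sort_run: "mset (stack_sort_run st xs) = mset st + mset xs"
  by (induction st xs rule: stack_sort_run.induct) auto

lemma mset_stack_sort [simp]: "mset (stack_sort p) = mset p"
  by (simp add: stack_sort_def mset_stack_sort_run)

lemma set_stack_sort_run: "set (stack_sort_run st xs) = set st \<union> set xs"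
  by (metis mset_stack_sort_run set_mset_mset set_mset_union)

lemma set_stack_sort [simp]: "set (stack_sort p) = set p"
  by (metis mset_stack_sort set_mset_mset)

lemma distinct_stack_sort [simp]: "distinct (stack_sort p) \<longleftrightarrow> distinct p"
  by (metis mset_stack_sort mset_eq_imp_distinct_iff)

text \<open>The configuration of the stack machine is read as the word \<open>rev st @ xs\<close>: a push leaves
  it unchanged.\<close>

lemma before_stack_sort_runD:
  assumes "before (stack_sort_run st xs) c b" "b < c"
    and "sorted_wrt (<) st" "distinct (st @ xs)"
  shows "\<exists>d>c. before (rev st @ xs) c d \<and> before (rev st @ xs) d b"
  using assms
proof (induction st xs rule: stack_sort_run.induct)
  case (3 y st x xs)
  show ?case
  proof (cases "x < y")
    case True
    then have "sorted_wrt (<) (x # y # st)" using 3 by auto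
    with True 3 show ?thesis by auto
  next
    case False
    with 3 have "y < x" by auto
    show ?thesis
    proof (cases "c = y")
      case True
      then have "b \<in> set xs"
        using 3 \<open>y < x\<close> by (auto simp: set_stack_sort_run dest!: before_in_set)
      \<comment> \<open>The entry \<open>x\<close> that forces the pop of \<open>y\<close> serves as
        \<open>d\<close>.\<close>
      with True \<open>y < x\<close> show ?thesis by (auto simp: before_append)
    next
      case c: False
      then have "before (stack_sort_run st (x # xs)) c b" using 3 False by auto
      then have "\<exists>d>c. before (rev st @ x # xs) c d \<and> before (rev st @ x # xs) d b"
        using 3 False by auto
      then show ?thesis by (auto simp: before_append)
    qed
  qed
next
  case (4 y st)
  \<comment> \<open>The stack increases from its top, so \<open>y\<close> is its least entry and
    cannot be the larger member of the pair.\<close>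
  then have "c \<noteq> y" by (auto simp: set_stack_sort_run dest!: before_in_set)
  with 4 have "\<exists>d>c. before (rev st @ []) c d \<and> before (rev st @ []) d b" by auto
  then show ?case by (auto simp: before_append)
qed auto

text \<open>Since \<open>rev st\<close> is decreasing, it has no ascent ending in \<open>d\<close>;
  so \<open>d\<close>, and with it everything later, is still unread.\<close>

lemma before_input:
  fixes c d :: nat
  assumes "before (rev st @ xs) c d" "before (rev st @ xs) d b" "c < d"
    and "sorted_wrt (<) st" "distinct (st @ xs)"
  shows "before xs d b"
proof -
  have "\<not> before st d c" using assms(3,4) less_asym unfolding sorted_wrt_before by blast
  then have "d \<in> set xs"
    using assms(1) by (auto simp: before_append before_rev dest: before_in_set)
  moreover from this have "d \<notin> set st" using assms(5) by auto
  ultimately show ?thesis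
    using assms(2) by (auto simp: before_append before_rev dest: before_in_set)
qed

text \<open>Pushing \<open>d\<close> requires that the smaller \<open>c\<close> has left the stack,
  and \<open>b\<close> is read only after \<open>d\<close>.\<close>

lemma before_stack_sort_runI:
  assumes "before (rev st @ xs) c d" "before (rev st @ xs) d b" "b < c" "c < d"
    and "sorted_wrt (<) st" "distinct (st @ xs)"
  shows "before (stack_sort_run st xs) c b"
  using assms
proof (induction st xs rule: stack_sort_run.induct)
  case (3 y st x xs)
  show ?case
  proof (cases "x < y")
    case True
    then have "sorted_wrt (<) (x # y # st)" using 3 by auto
    with True 3 show ?thesis by auto
  next
    case False
    have db: "before (x # xs) d b" using before_input[OF 3(3,4,6-)] .
    note in_set = before_in_set[OF db]
    show ?thesis
    proof (cases "c = y")
      case True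
      then show ?thesis using False in_set by (auto simp: set_stack_sort_run)
    next
      case c: False
      have "d \<noteq> y" using in_set 3 by auto
      then have "before (rev st @ x # xs) c d"
        using 3(3) c by (auto simp: before_append)
      moreover have "before (rev st @ x # xs) d b" using db by (simp add: before_append)
      ultimately have "before (stack_sort_run st (x # xs)) c b"
        using 3 False by (intro 3(2)) auto
      then show ?thesis using False by simp
    qed
  qed
next
  case (4 y st)
  then show ?case using before_input[of "y # st" "[]" c d b] by simp
qed auto

lemma before_stack_sort_iff:
  assumes "distinct p" "b < c"
  shows "before (stack_sort p) c b \<longleftrightarrow> (\<exists>d>c. before p c d \<and> before p d b)"
  using before_stack_sort_runD[of "[]" p c b] before_stack_sort_runI[of "[]" p c _ b] assms
  by (auto simp: stack_sort_def)


section \<open>A pattern class of stack-sortable permutations\<close>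

text \<open>For \<open>t \<ge> 1\<close> this is avoidance of all patterns of length \<open>t + 2\<close> that end in
  \<open>t + 2, 1\<close>.\<close>

definition kremer :: "nat \<Rightarrow> nat list \<Rightarrow> bool" where
  "kremer t p \<longleftrightarrow>
     (\<forall>d b. b < d \<longrightarrow> before p d b \<longrightarrow> card {c. before p c d \<and> b < c \<and> c < d} < t)"

text \<open>A descent \<open>d\<close>, \<open>b\<close> of the output comes from some
  \<open>e > d\<close> between them in \<open>p\<close>. Every \<open>c\<close> counted for
  \<open>d\<close>, \<open>b\<close> also precedes \<open>e\<close> in \<open>p\<close>, since
  otherwise \<open>e\<close> would force \<open>d\<close> out before \<open>c\<close>. Thus
  \<open>e\<close>, \<open>b\<close> has at least one more witness in \<open>p\<close>, namely
  \<open>d\<close> itself.\<close>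

lemma kremer_stack_sort:
  assumes "distinct p" "kremer (Suc t) p"
  shows "kremer t (stack_sort p)"
  unfolding kremer_def
proof (intro allI impI)
  fix d b assume "b < d" and db: "before (stack_sort p) d b"
  let ?S = "{c. before (stack_sort p) c d \<and> b < c \<and> c < d}"
  obtain e where e: "d < e" "before p d e" "before p e b"
    using before_stack_sort_iff[OF assms(1) \<open>b < d\<close>] db by auto
  have "before p c e" if c: "c \<in> ?S" for c
  proof (rule ccontr)
    assume "\<not> before p c e"
    then have "before p e c"
      using before_total[of c p e] c e before_in_set[of "stack_sort p" c d]
        before_in_set[of p d e] by auto
    then have "before (stack_sort p) d c"
      using before_stack_sort_iff[OF assms(1), of c d] c e by auto
    then show False using before_antisym[of "stack_sort p" c d] c assms(1) by auto
  qed
  then have "insert d ?S \<subseteq> {c. before p c e \<and> b < c \<and> c < e}"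
    using e \<open>b < d\<close> by auto
  then have "card (insert d ?S) \<le> card {c. before p c e \<and> b < c \<and> c < e}"
    by (intro card_mono) auto
  also have "\<dots> < Suc t"
    using assms(2) e \<open>b < d\<close> unfolding kremer_def by auto
  finally show "card ?S < t" by simp
qed

lemma stack_sortable_Suc: "stack_sortable (Suc t) p \<longleftrightarrow> stack_sortable t (stack_sort p)"
  by (simp add: stack_sortable_def funpow_swap1)

text \<open>Each pass lowers the parameter by one, and \<open>kremer 0\<close> forbids all descents
  because no cardinality is below 0.\<close>

lemma kremer_stack_sortable:
  "distinct p \<Longrightarrow> kremer t p \<Longrightarrow> stack_sortable t p"
proof (induction t arbitrary: p)
  case 0
  have "x < y" if "before p x y" for x y
  proof -
    have "x \<noteq> y" using before_antisym[OF 0(1) that] that by auto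
    moreover have "\<not> y < x" using 0(2) that by (auto simp: kremer_def)
    ultimately show ?thesis by simp
  qed
  then show ?case by (simp add: stack_sortable_def sorted_wrt_before)
next
  case (Suc t)
  then show ?case
    using kremer_stack_sort[of p t] by (simp add: stack_sortable_Suc)
qed

section \<open>Growing the class by appending last entries\<close>

definition relabel :: "nat \<Rightarrow> nat \<Rightarrow> nat" where
  "relabel w x = (if x < w then x else Suc x)"

text \<open>Gap 0 appends a new maximum, gap \<open>length p\<close> a new minimum.\<close>

definition append_gap :: "nat list \<Rightarrow> nat \<Rightarrow> nat list" where
  "append_gap p g = (let w = Suc (length p) - g in map (relabel w) p @ [w])"

text \<open>The value \<open>v\<close> can be appended, shifting up the entries \<open>\<ge> v\<close>, without
  leaving the class.\<close>

definition appendable :: "nat \<Rightarrow> nat \<Rightarrow> nat list \<Rightarrow> bool" where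
  "appendable t v p \<longleftrightarrow>
     (\<forall>d\<in>set p. v \<le> d \<longrightarrow> card {c. before p c d \<and> v \<le> c \<and> c < d} < t)"

text \<open>The values certified are the top \<open>q + 1\<close> ones, from
  \<open>length p + 1 - q\<close> to \<open>length p + 1\<close>. More may be appendable; a lower
  bound suffices for counting from below.\<close>

definition kremer_state :: "nat \<Rightarrow> nat \<Rightarrow> nat list \<Rightarrow> bool" where
  "kremer_state t q p \<longleftrightarrow> distinct p \<and> set p = {1..length p} \<and> kremer t p \<and> q \<le> length p \<and>
     (\<forall>v. length p < v + q \<longrightarrow> appendable t v p)"

lemma inj_relabel: "inj (relabel w)"
  by (auto simp: inj_on_def relabel_def split: if_splits)

lemma relabel_less_iff: "relabel w x < relabel w y \<longleftrightarrow> x < y"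
  by (auto simp: relabel_def)

text \<open>Old entries impose the old condition with one gap more, which gives
  \<open>Suc q\<close>. The new entry \<open>w\<close>, in the role of \<open>d\<close>, has at most
  \<open>w - v\<close> witnesses and so allows every \<open>v > w - t\<close>, which gives
  \<open>g + t\<close>.\<close>

lemma kremer_state_append_gap:
  assumes st: "kremer_state t q p" and g: "g \<le> q"
  shows "kremer_state t (min (Suc q) (g + t)) (append_gap p g)"
proof -
  define n where "n = length p"
  define w where "w = Suc n - g"
  define f where "f = relabel w"
  define p' where "p' = map f p @ [w]"
  have p': "append_gap p g = p'"
    by (simp add: append_gap_def p'_def f_def w_def n_def Let_def)
  have q: "q \<le> n" "distinct p" "set p = {1..n}" "kremer t p"
    and app: "\<And>v. n < v + q \<Longrightarrow> appendable t v p"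
    using st by (auto simp: kremer_state_def n_def)
  have w: "1 \<le> w" "w \<le> Suc n" "w + g = Suc n" using q g by (auto simp: w_def)
  have fw: "f x \<noteq> w" for x by (auto simp: f_def relabel_def)
  have f_less: "f x < f y \<longleftrightarrow> x < y" for x y
    by (simp add: f_def relabel_less_iff)
  have inj: "inj f" by (simp add: f_def inj_relabel)
  have bef: "before p' x y \<longleftrightarrow> (\<exists>x' y'. x = f x' \<and> y = f y' \<and> before p x' y') \<or>
      (x \<in> f ` set p \<and> y = w)" for x y
    by (auto simp: p'_def before_append before_map)
  have bef_f: "before p' x (f y) \<longleftrightarrow> (\<exists>x'. x = f x' \<and> before p x' y)" for x y
    using inj fw[of y] by (auto simp: bef inj_eq)
  have len: "length p' = Suc n" by (simp add: p'_def n_def)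
  have dist: "distinct p'"
    using q(2) fw inj by (auto simp: p'_def distinct_map intro: inj_on_subset)
  have "set p' \<subseteq> {1..Suc n}" using q w by (auto simp: p'_def f_def relabel_def)
  then have set: "set p' = {1..length p'}"
    using distinct_card[OF dist] len by (metis card_atLeastAtMost card_subset_eq diff_Suc_1 finite_atLeastAtMost)
  \<comment> \<open>The new last entry precedes nothing, so all witnesses for an old
    \<open>d\<close> are images of witnesses in \<open>p\<close>.\<close>
  have card_le: "card {c'. before p' c' (f d) \<and> v' \<le> c' \<and> c' < f d}
      \<le> card {c. before p c d \<and> v \<le> c \<and> c < d}"
    if "\<And>x. v' \<le> f x \<Longrightarrow> v \<le> x" for v v' d
  proof -
    have "{c'. before p' c' (f d) \<and> v' \<le> c' \<and> c' < f d}
       \<subseteq> f ` {c. before p c d \<and> v \<le> c \<and> c < d}"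
      using that by (auto simp: bef_f f_less)
    then have "card {c'. before p' c' (f d) \<and> v' \<le> c' \<and> c' < f d}
       \<le> card (f ` {c. before p c d \<and> v \<le> c \<and> c < d})"
      by (intro card_mono) auto
    also have "\<dots> \<le> card {c. before p c d \<and> v \<le> c \<and> c < d}"
      by (intro card_image_le) auto
    finally show ?thesis .
  qed
  have kr: "kremer t p'"
    unfolding kremer_def
  proof (intro allI impI)
    fix d' b' assume "b' < d'" and "before p' d' b'"
    then consider d b where "d' = f d" "b' = f b" "before p d b"
      | d where "d' = f d" "d \<in> set p" "b' = w"
      by (auto simp: bef)
    then show "card {c. before p' c d' \<and> b' < c \<and> c < d'} < t"
    proof cases
      case 1
      have "card {c'. before p' c' (f d) \<and> Suc (f b) \<le> c' \<and> c' < f d}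
         \<le> card {c. before p c d \<and> Suc b \<le> c \<and> c < d}"
        by (rule card_le) (simp add: Suc_le_eq f_less)
      also have "\<dots> < t"
        using q(4) 1 \<open>b' < d'\<close> by (auto simp: kremer_def f_less Suc_le_eq)
      finally show ?thesis using 1 by (simp add: Suc_le_eq)
    next
      case 2
      have "card {c'. before p' c' (f d) \<and> Suc w \<le> c' \<and> c' < f d}
         \<le> card {c. before p c d \<and> w \<le> c \<and> c < d}"
        by (rule card_le) (auto simp: f_def relabel_def split: if_splits)
      also have "\<dots> < t"
      proof -
        have "w \<le> d" using 2 \<open>b' < d'\<close> by (auto simp: f_def relabel_def split: if_splits)
        then show ?thesis using app[of w] w g 2 by (auto simp: appendable_def)
      qed
      finally show ?thesis using 2 by (simp add: Suc_le_eq)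
    qed
  qed
  have "appendable t v p'" if v: "length p' < v + min (Suc q) (g + t)" for v
    unfolding appendable_def
  proof (intro ballI impI)
    fix d' assume "d' \<in> set p'" "v \<le> d'"
    then consider d where "d' = f d" "d \<in> set p" | "d' = w" by (auto simp: p'_def)
    then show "card {c. before p' c d' \<and> v \<le> c \<and> c < d'} < t"
    proof cases
      case 1
      \<comment> \<open>Thresholds above the inserted \<open>w\<close> are shifted back by
        one.\<close>
      define v0 where "v0 = (if v \<le> w then v else v - 1)"
      have le: "v0 \<le> x" if "v \<le> f x" for x
        using that by (auto simp: v0_def f_def relabel_def split: if_splits)
      have "n < v0 + q"
        using v w g q len by (auto simp: v0_def)
      then have "card {c. before p c d \<and> v0 \<le> c \<and> c < d} < t"
        using app[of v0] 1 le \<open>v \<le> d'\<close> by (auto simp: appendable_def)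
      then show ?thesis using card_le[of v v0 d] le 1 by auto
    next
      case 2
      have "card {c. before p' c d' \<and> v \<le> c \<and> c < d'} \<le> card {v..<w}"
        using 2 by (intro card_mono) auto
      also have "\<dots> < t" using v len w \<open>v \<le> d'\<close> 2 by auto
      finally show ?thesis .
    qed
  qed
  then show ?thesis
    unfolding p' kremer_state_def using dist set kr len q by auto
qed

text \<open>Codes record the gaps, counted from the top, of the successively appended last entries.
  An entry appended in gap \<open>g\<close> leaves available the gaps above itself and \<open>t\<close> gaps below.\<close>

fun codes :: "nat \<Rightarrow> nat \<Rightarrow> nat \<Rightarrow> nat list set" where
  "codes t 0 q = {[]}"
| "codes t (Suc m) q = (\<Union>g\<in>{..q}. (#) g ` codes t m (min (Suc q) (g + t)))"

lemma finite_codes [simp]: "finite (codes t m q)"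
  by (induction m arbitrary: q) auto

lemma card_codes_Suc:
  "card (codes t (Suc m) q) = (\<Sum>g\<le>q. card (codes t m (min (Suc q) (g + t))))"
  by (subst codes.simps, subst card_UN_disjoint) (auto simp: card_image)

lemma length_codes: "gs \<in> codes t m q \<Longrightarrow> length gs = m"
  by (induction m arbitrary: q gs) auto

lemma kremer_state_foldl:
  "kremer_state t q p \<Longrightarrow> gs \<in> codes t m q \<Longrightarrow> \<exists>q'. kremer_state t q' (foldl append_gap p gs)"
  by (induction m arbitrary: q p gs) (auto dest: kremer_state_append_gap)

lemma length_foldl_append_gap:
  "length (foldl append_gap p gs) = length p + length gs"
  by (induction gs arbitrary: p) (auto simp: append_gap_def Let_def)

text \<open>The last entry determines the gap, as \<open>g\<close> is at most the length and the
  subtraction does not truncate; undoing the injective relabelling then recovers the shorter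
  list.\<close>

lemma inj_foldl_append_gap:
  assumes "foldl append_gap p gs = foldl append_gap p' gs'"
    and "gs \<in> codes t m q" "gs' \<in> codes t m q'" "length p = length p'"
    and "q \<le> length p" "q' \<le> length p'"
  shows "p = p' \<and> gs = gs'"
  using assms
proof (induction m arbitrary: p p' q q' gs gs')
  case (Suc m)
  obtain g hs g' hs' where g: "gs = g # hs" "g \<le> q" "hs \<in> codes t m (min (Suc q) (g + t))"
    and g': "gs' = g' # hs'" "g' \<le> q'" "hs' \<in> codes t m (min (Suc q') (g' + t))"
    using Suc.prems by auto
  have len: "length (append_gap r h) = Suc (length r)" for r h
    by (simp add: append_gap_def Let_def)
  have "append_gap p g = append_gap p' g' \<and> hs = hs'"
    using Suc.prems g g' by (intro Suc.IH) (auto simp: len)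
  then show ?case
    using Suc.prems g g' inj_relabel inj_map_eq_map by (auto simp: append_gap_def Let_def)
qed auto

lemma finite_stack_sortable [simp]:
  "finite {p \<in> permutations_of_set {1..n}. stack_sortable t p}"
  by (rule finite_subset[of _ "permutations_of_set {1..n}"]) auto

lemma card_codes_le_num_stack_sortable:
  "card (codes t n 0) \<le> num_stack_sortable t n"
  unfolding num_stack_sortable_def
proof (rule card_inj_on_le)
  show "inj_on (foldl append_gap []) (codes t n 0)"
    using inj_foldl_append_gap[of "[]" _ "[]"] by (auto intro: inj_onI)
  have st: "kremer_state t 0 []"
    by (simp add: kremer_state_def kremer_def appendable_def)
  show "foldl append_gap [] ` codes t n 0 \<subseteq> {p \<in> permutations_of_set {1..n}. stack_sortable t p}"
    using kremer_state_foldl[OF st]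
    by (fastforce simp: permutations_of_set_def kremer_state_def length_foldl_append_gap
        length_codes intro: kremer_stack_sortable)
qed simp


section \<open>Exponential growth of the number of codes\<close>

text \<open>The function \<open>eigen t l\<close> solves the eigenvalue equation of the linear recursion for the
  number of codes. Below the critical value \<open>(sqrt t + 1)\<^sup>2\<close> the characteristic roots are not real,
  so that it changes sign; cut off there it is a subsolution.\<close>

fun eigen :: "real \<Rightarrow> real \<Rightarrow> nat \<Rightarrow> real" where
  "eigen t l 0 = 1"
| "eigen t l (Suc 0) = (l - 1) / t"
| "eigen t l (Suc (Suc k)) = ((l + t - 1) * eigen t l (Suc k) - l * eigen t l k) / t"

text \<open>This is the eigenvalue equation at \<open>q = k + t\<close>: gaps up to \<open>k\<close>
  lead to \<open>g + t\<close>, the other \<open>t\<close> gaps to \<open>q + 1\<close>. The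
  recursion defining \<open>eigen\<close> is the difference of two consecutive such
  equations.\<close>

lemma eigen_eq:
  assumes "t > 0"
  shows "t * eigen t l (Suc k) + (\<Sum>j\<le>k. eigen t l j) = l * eigen t l k"
proof (induction k)
  case (Suc k)
  then have "(\<Sum>j\<le>Suc k. eigen t l j) = l * eigen t l k + (1 - t) * eigen t l (Suc k)"
    by (simp add: algebra_simps)
  moreover have "t * eigen t l (Suc (Suc k)) = (l + t - 1) * eigen t l (Suc k) - l * eigen t l k"
    using assms by simp
  ultimately show ?case by (simp add: algebra_simps del: eigen.simps)
qed (use assms in simp)

text \<open>If all values were positive, so would be the ratios \<open>r k\<close> of consecutive
  values. By the inequality of arithmetic and geometric means they drop by at least a fixed positive
  amount at each step, which is absurd.\<close>

lemma eigen_sign_change: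
  assumes t: "t > 0" and s: "sqrt t < s" "s < sqrt t + 1"
  shows "\<exists>k. eigen t (s\<^sup>2) k \<le> 0"
proof (rule ccontr)
  assume "\<nexists>k. eigen t (s\<^sup>2) k \<le> 0"
  then have pos: "eigen t (s\<^sup>2) k > 0" for k by (simp add: not_le)
  define r where "r k = eigen t (s\<^sup>2) (Suc k) / eigen t (s\<^sup>2) k" for k
  define \<delta> where "\<delta> = (1 - (s - sqrt t)\<^sup>2) / t"
  have r_pos: "r k > 0" for k using pos by (simp add: r_def)
  have "\<bar>s - sqrt t\<bar> < 1" using s by auto
  then have "(s - sqrt t)\<^sup>2 < 1" by (simp add: abs_square_less_1)
  then have "\<delta> > 0" using t by (simp add: \<delta>_def)
  have step: "r (Suc k) \<le> r k - \<delta>" for k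
  proof -
    have "t * r (Suc k) = s\<^sup>2 + t - 1 - s\<^sup>2 / r k"
      using pos[of k] pos[of "Suc k"] t by (simp add: r_def field_simps)
    moreover have "t * r k + s\<^sup>2 / r k \<ge> 2 * sqrt t * s"
    proof -
      have "0 \<le> (sqrt t * r k - s)\<^sup>2" by simp
      then have "2 * sqrt t * s * r k \<le> t * (r k)\<^sup>2 + s\<^sup>2"
        using t by (simp add: power2_diff power_mult_distrib algebra_simps)
      then show ?thesis using r_pos[of k] by (simp add: field_simps power2_eq_square)
    qed
    moreover have "t * \<delta> = 1 - (s - sqrt t)\<^sup>2" using t by (simp add: \<delta>_def)
    then have "t * (r k - \<delta>) = t * r k - 1 + s\<^sup>2 + t - 2 * sqrt t * s"
      using t by (simp add: right_diff_distrib power2_diff)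
    ultimately have "t * r (Suc k) \<le> t * (r k - \<delta>)" by linarith
    then show ?thesis using t by simp
  qed
  have bound: "r k \<le> r 0 - real k * \<delta>" for k
  proof (induction k)
    case (Suc k)
    then show ?case using step[of k] by (simp add: algebra_simps)
  qed simp
  obtain k where "r 0 < real k * \<delta>" using \<open>\<delta> > 0\<close> reals_Archimedean3 by blast
  then show False using bound[of k] r_pos[of k] by simp
qed

text \<open>The recursion for the number of codes has nonnegative coefficients, so the subsolution
  inequality can be iterated, starting from \<open>v q <= B\<close>.\<close>

lemma codes_eigen_bound:
  fixes v :: "nat \<Rightarrow> real"
  assumes "\<And>q. v q \<le> B" "l \<ge> 0"
    and sub: "\<And>q. l * v q \<le> (\<Sum>g\<le>q. v (min (Suc q) (g + t)))"
  shows "l ^ m * v q \<le> B * card (codes t m q)"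
proof (induction m arbitrary: q)
  case (Suc m)
  have "l ^ Suc m * v q = l ^ m * (l * v q)" by simp
  also have "\<dots> \<le> l ^ m * (\<Sum>g\<le>q. v (min (Suc q) (g + t)))"
    using sub assms(2) by (intro mult_left_mono) auto
  also have "\<dots> \<le> (\<Sum>g\<le>q. B * card (codes t m (min (Suc q) (g + t))))"
    unfolding sum_distrib_left by (intro sum_mono Suc.IH)
  finally show ?case by (simp add: card_codes_Suc sum_distrib_left del: codes.simps)
qed (use assms in auto)

text \<open>Choosing the last gap \<open>g = q\<close> raises the state by exactly one;
  \<open>k\<close> such choices lead from \<open>q\<close> to \<open>k + q\<close>.\<close>

lemma card_codes_shift:
  assumes "t \<ge> 1"
  shows "card (codes t m (k + q)) \<le> card (codes t (k + m) q)"
proof (induction k arbitrary: q)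
  case (Suc k)
  have "card (codes t m (k + Suc q)) \<le> card (codes t (k + m) (Suc q))" by (rule Suc.IH)
  also have "\<dots> = card (codes t (k + m) (min (Suc q) (q + t)))"
    using assms by (simp add: min_def)
  also have "\<dots> \<le> card (codes t (Suc (k + m)) q)"
    unfolding card_codes_Suc by (rule member_le_sum) auto
  finally show ?case by simp
qed simp

text \<open>The subsolution is \<open>eigen\<close> shifted by \<open>t\<close> and cut off at its
  first nonpositive value. Its support starts at state \<open>t\<close>, reached from 0 in
  \<open>t\<close> steps.\<close>

lemma card_codes_growth:
  fixes s :: real
  assumes "t \<ge> 1" and s: "sqrt t < s" "s < sqrt t + 1"
  shows "\<exists>c>0. \<forall>m. c * (s\<^sup>2) ^ m \<le> card (codes t (t + m) 0)"
proof -
  define w where "w = eigen t (s\<^sup>2)"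
  define H where "H = (LEAST k. w k \<le> 0)"
  have ex: "\<exists>k. w k \<le> 0" using eigen_sign_change[of t s] assms by (simp add: w_def)
  have H1: "w H \<le> 0" unfolding H_def using LeastI_ex[OF ex] .
  have H2: "w k > 0" if "k < H" for k
    using not_less_Least[of k "\<lambda>k. w k \<le> 0"] that unfolding H_def by simp
  have "w 0 = 1" by (simp add: w_def)
  then have "H \<noteq> 0" using H1 by (intro notI) simp
  define v where "v q = (if t \<le> q \<and> q < t + H then w (q - t) else 0)" for q
  have v_nonneg: "v q \<ge> 0" for q using H2[of "q - t"] by (auto simp: v_def less_imp_le)
  define B where "B = (\<Sum>k<H. w k)"
  have vB: "v q \<le> B" for q
    unfolding v_def B_def using H2
    by (auto intro!: member_le_sum sum_nonneg simp: less_imp_le)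
  have "B > 0" unfolding B_def using H2 \<open>H \<noteq> 0\<close> by (intro sum_pos) auto
  have sub: "s\<^sup>2 * v q \<le> (\<Sum>g\<le>q. v (min (Suc q) (g + t)))" for q
  proof (cases "t \<le> q \<and> q < t + H")
    case True
    define k where "k = q - t"
    have k: "q = k + t" "k < H" using True by (auto simp: k_def)
    \<comment> \<open>The split is where the minimum switches from \<open>g + t\<close> to
      \<open>Suc q\<close>.\<close>
    have "{..q} = {..k} \<union> {k<..k + t}" using k by auto
    then have "(\<Sum>g\<le>q. v (min (Suc q) (g + t)))
        = (\<Sum>g\<le>k. v (min (Suc q) (g + t))) + (\<Sum>g\<in>{k<..k + t}. v (min (Suc q) (g + t)))"
      by (simp add: sum.union_disjoint Int_def)
    also have "(\<Sum>g\<le>k. v (min (Suc q) (g + t))) = (\<Sum>g\<le>k. w g)"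
      using k by (intro sum.cong) (auto simp: v_def min_def)
    also have "(\<Sum>g\<in>{k<..k + t}. v (min (Suc q) (g + t))) = (\<Sum>g\<in>{k<..k + t}. v (Suc q))"
      using k by (intro sum.cong) (auto simp: min_def)
    also have "\<dots> = t * v (Suc q)" by simp
    finally have "(\<Sum>g\<le>q. v (min (Suc q) (g + t))) = (\<Sum>g\<le>k. w g) + t * v (Suc q)" .
    \<comment> \<open>At the cut-off, 0 replaces a nonpositive value, which only helps.\<close>
    moreover have "w (Suc k) \<le> v (Suc q)"
    proof (cases "Suc k < H")
      case False
      then have "Suc k = H" using k by simp
      then show ?thesis using H1 v_nonneg[of "Suc q"] by simp
    qed (use k in \<open>simp add: v_def\<close>)
    then have "t * w (Suc k) \<le> t * v (Suc q)" by (intro mult_left_mono) auto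
    moreover have "t * w (Suc k) + (\<Sum>g\<le>k. w g) = s\<^sup>2 * w k"
      using eigen_eq[of t "s\<^sup>2" k] assms by (simp add: w_def)
    moreover have "v q = w k" using k by (simp add: v_def)
    ultimately show ?thesis by simp
  next
    case False
    then have "v q = 0" by (simp only: v_def if_False)
    then show ?thesis using v_nonneg by (simp add: sum_nonneg)
  qed
  have "v t = 1" using \<open>H \<noteq> 0\<close> by (simp add: v_def w_def)
  have "1 / B * (s\<^sup>2) ^ m \<le> card (codes t (t + m) 0)" for m
  proof -
    have "(s\<^sup>2) ^ m \<le> B * card (codes t m t)"
      using codes_eigen_bound[of v B "s\<^sup>2" t m t] vB sub \<open>v t = 1\<close> by simp
    also have "\<dots> \<le> B * card (codes t (t + m) 0)"
      using card_codes_shift[OF assms(1), of m t 0] \<open>B > 0\<close> by simp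
    finally show ?thesis using \<open>B > 0\<close> by (simp add: field_simps)
  qed
  then show ?thesis using \<open>B > 0\<close> by (intro exI[of _ "1 / B"]) auto
qed


section \<open>Existence of the limit\<close>

fun stack_word :: "nat list \<Rightarrow> nat list \<Rightarrow> bool list" where
  "stack_word [] [] = []"
| "stack_word [] (x # xs) = True # stack_word [x] xs"
| "stack_word (y # st) (x # xs) =
     (if x < y then True # stack_word (x # y # st) xs
      else False # stack_word st (x # xs))"
| "stack_word (y # st) [] = False # stack_word st []"

lemma length_stack_word: "length (stack_word st xs) = length st + 2 * length xs"
  by (induction st xs rule: stack_word.induct) auto

text \<open>The word matches each pop with its push, and the output names the entry popped.\<close>

lemma stack_word_inj:
  assumes "stack_word st xs = stack_word st' xs'" "stack_sort_run st xs = stack_sort_run st' xs'"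
  shows "st = st' \<and> xs = xs'"
  using assms
proof (induction st xs arbitrary: st' xs' rule: stack_word.induct)
  case 1
  then show ?case by (cases "(st', xs')" rule: stack_word.cases) (auto split: if_splits)
next
  case (2 x xs)
  then show ?case by (cases "(st', xs')" rule: stack_word.cases) (fastforce split: if_splits)+
next
  case (3 y st x xs)
  then show ?case by (cases "(st', xs')" rule: stack_word.cases) (fastforce split: if_splits)+
next
  case (4 y st)
  then show ?case by (cases "(st', xs')" rule: stack_word.cases) (fastforce split: if_splits)+
qed

lemma permutations_of_set_stack_sort:
  "p \<in> permutations_of_set A \<Longrightarrow> stack_sort p \<in> permutations_of_set A"
  by (auto simp: permutations_of_set_def)

text \<open>Each pass is undone by a word of length \<open>2 * n\<close>, at most
  \<open>4 ^ n\<close> choices, and only the identity remains at the end.\<close>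

lemma num_stack_sortable_upper: "num_stack_sortable t n \<le> 4 ^ (t * n)"
proof (induction t)
  case 0
  have "p = sorted_list_of_set {1..n}"
    if "p \<in> permutations_of_set {1..n}" "stack_sortable 0 p" for p
    using that by (intro sorted_distinct_set_unique)
      (auto simp: stack_sortable_def permutations_of_set_def strict_sorted_iff)
  then have "{p \<in> permutations_of_set {1..n}. stack_sortable 0 p} \<subseteq> {sorted_list_of_set {1..n}}"
    by blast
  then have "card {p \<in> permutations_of_set {1..n}. stack_sortable 0 p} \<le> card {sorted_list_of_set {1..n}}"
    by (intro card_mono) auto
  then show ?case by (simp add: num_stack_sortable_def)
next
  case (Suc t)
  let ?A = "\<lambda>t. {p \<in> permutations_of_set {1..n}. stack_sortable t p}"
  let ?W = "{w :: bool list. set w \<subseteq> UNIV \<and> length w = 2 * n}"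
  have fin: "finite ?W" by (rule finite_lists_length_eq) simp
  have "card (?A (Suc t)) \<le> card (?W \<times> ?A t)"
  proof (rule card_inj_on_le)
    show "inj_on (\<lambda>p. (stack_word [] p, stack_sort p)) (?A (Suc t))"
      using stack_word_inj[of "[]" _ "[]"] by (auto simp: stack_sort_def intro: inj_onI)
    show "(\<lambda>p. (stack_word [] p, stack_sort p)) ` ?A (Suc t) \<subseteq> ?W \<times> ?A t"
      by (auto simp: length_stack_word stack_sortable_Suc
          length_finite_permutations_of_set permutations_of_set_stack_sort)
    show "finite (?W \<times> ?A t)" using fin by simp
  qed
  also have "\<dots> = 4 ^ n * num_stack_sortable t n"
    unfolding card_cartesian_product num_stack_sortable_def
    by (subst card_lists_length_eq) (simp_all add: power_mult)
  also have "\<dots> \<le> 4 ^ n * 4 ^ (t * n)" using Suc by simp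
  finally show ?case by (simp add: num_stack_sortable_def power_add)
qed

section \<open>Direct sums and supermultiplicativity\<close>

text \<open>The first entry of \<open>ys\<close> exceeds everything on the stack and empties
  it.\<close>

lemma stack_sort_run_append:
  assumes "\<forall>x\<in>set st \<union> set xs. \<forall>y\<in>set ys. x < y"
  shows "stack_sort_run st (xs @ ys) = stack_sort_run st xs @ stack_sort ys"
  using assms
proof (induction st xs rule: stack_sort_run.induct)
  case (4 y st)
  then show ?case by (cases ys) (auto simp: stack_sort_def)
qed (auto simp: stack_sort_def)

lemma stack_sort_append:
  assumes "\<forall>x\<in>set xs. \<forall>y\<in>set ys. x < y"
  shows "stack_sort (xs @ ys) = stack_sort xs @ stack_sort ys"
  using stack_sort_run_append[of "[]" xs ys] assms by (simp add: stack_sort_def)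

lemma stack_sort_map:
  assumes "strict_mono f"
  shows "stack_sort (map f xs) = map f (stack_sort xs)"
proof -
  have "stack_sort_run (map f st) (map f xs) = map f (stack_sort_run st xs)" for st xs
    by (induction st xs rule: stack_sort_run.induct) (auto simp: strict_mono_less[OF assms])
  from this[of "[]"] show ?thesis by (simp add: stack_sort_def)
qed

lemma stack_sortable_append:
  assumes "\<forall>x\<in>set p. \<forall>y\<in>set q. x < y" "stack_sortable t p" "stack_sortable t q"
  shows "stack_sortable t (p @ q)"
  using assms
proof (induction t arbitrary: p q)
  case (Suc t)
  then show ?case by (simp add: stack_sortable_Suc stack_sort_append)
qed (simp add: stack_sortable_def sorted_wrt_append)

lemma stack_sortable_map:
  assumes "strict_mono f" "stack_sortable t p"
  shows "stack_sortable t (map f p)"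
  using assms(2)
proof (induction t arbitrary: p)
  case 0
  then show ?case
    by (simp add: stack_sortable_def sorted_wrt_map strict_mono_less[OF assms(1)])
next
  case (Suc t)
  then show ?case by (simp add: stack_sortable_Suc stack_sort_map[OF assms(1)])
qed

lemma num_stack_sortable_supermult:
  "num_stack_sortable t m * num_stack_sortable t n \<le> num_stack_sortable t (m + n)"
proof -
  let ?A = "\<lambda>n. {p \<in> permutations_of_set {1..n}. stack_sortable t p}"
  let ?f = "\<lambda>(p, q). p @ map ((+) m) q"
  have "card (?A m \<times> ?A n) \<le> card (?A (m + n))"
  proof (rule card_inj_on_le)
    show "inj_on ?f (?A m \<times> ?A n)"
      by (auto intro!: inj_onI simp: length_finite_permutations_of_set)
    have "(+) m ` {1..n} = {m + 1..m + n}" by (simp add: add.commute)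
    then have "{1..m} \<union> (+) m ` {1..n} = {1..m + n}" by auto
    then show "?f ` (?A m \<times> ?A n) \<subseteq> ?A (m + n)"
      by (auto simp: permutations_of_set_def distinct_map strict_mono_def
          intro!: stack_sortable_append stack_sortable_map)
  qed simp
  then show ?thesis by (simp add: num_stack_sortable_def card_cartesian_product)
qed

section \<open>Fekete's lemma and the limit\<close>

text \<open>The limit is the supremum \<open>L\<close>: for a nearly optimal \<open>m\<close>, write
  \<open>n = k * m + n mod m\<close> and drop the nonnegative remainder term.\<close>

lemma fekete_superadditive:
  fixes u :: "nat \<Rightarrow> real" and C :: real
  assumes super: "\<And>m n. u m + u n \<le> u (m + n)"
    and nonneg: "\<And>n. 0 \<le> u n" and bound: "\<And>n. u n \<le> C * n"
  shows "convergent (\<lambda>n. u n / n)"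
proof -
  define L where "L = (SUP n\<in>{1..}. u n / n)"
  have bdd: "bdd_above ((\<lambda>n. u n / n) ` {1..})"
    by (rule bdd_aboveI2[of _ _ C]) (use bound in \<open>auto simp: pos_divide_le_eq\<close>)
  have le_L: "u n / n \<le> L" if "n \<ge> 1" for n
    unfolding L_def using that by (intro cSUP_upper bdd) auto
  have mult: "real k * u m \<le> u (k * m)" for k m
  proof (induction k)
    case (Suc k)
    then show ?case using super[of m "k * m"] by (simp add: algebra_simps)
  qed (simp add: nonneg)
  have "(\<lambda>n. u n / n) \<longlonglongrightarrow> L"
  proof (rule LIMSEQ_I)
    fix e :: real assume "e > 0"
    then have "L - e / 2 < L" by simp
    then obtain m where m: "m \<ge> 1" "L - e / 2 < u m / m"
      unfolding L_def by (subst (asm) less_cSUP_iff) (use bdd in auto)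
    \<comment> \<open>Beyond \<open>N\<close> the error \<open>u m / n\<close> of the division is
      below \<open>e / 2\<close>.\<close>
    obtain N where N: "2 * u m / e < real N" using reals_Archimedean2 by blast
    have "norm (u n / n - L) < e" if "n \<ge> max 1 N" for n
    proof -
      have n: "n \<ge> 1" "real n \<ge> N" using that by auto
      define k where "k = n div m"
      have "n = k * m + n mod m" by (simp add: k_def)
      then have "u n \<ge> u (k * m)"
        using super[of "k * m" "n mod m"] nonneg[of "n mod m"] by simp
      then have un: "u n \<ge> real k * u m" using mult[of k m] by simp
      have "n mod m < m" using m by simp
      then have "n < (k + 1) * m" using \<open>n = k * m + n mod m\<close> by (simp add: add.commute)
      then have "real n \<le> real k * m + m" by (simp flip: of_nat_mult of_nat_add)
      then have "real n * u m \<le> (real k * m + m) * u m"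
        by (intro mult_right_mono nonneg)
      also have "\<dots> \<le> m * (u n + u m)" using un m by (simp add: algebra_simps mult_left_mono)
      finally have "u m / m \<le> u n / n + u m / n"
        using m n by (simp add: field_simps)
      moreover have "u m / n < e / 2"
      proof -
        have "2 * u m < real N * e" using N \<open>e > 0\<close> by (simp add: field_simps)
        also have "\<dots> \<le> real n * e" using n \<open>e > 0\<close> by simp
        finally show ?thesis using n by (simp add: field_simps)
      qed
      ultimately have "L - e < u n / n" using m by linarith
      then show ?thesis using le_L[OF n(1)] \<open>e > 0\<close> by (simp add: abs_less_iff)
    qed
    then show "\<exists>no. \<forall>n\<ge>no. norm (u n / n - L) < e" by blast
  qed
  then show ?thesis by (rule convergentI)
qed

text \<open>This makes the logarithms in Fekete's lemma nonnegative.\<close>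

lemma num_stack_sortable_pos:
  assumes "t \<ge> 1"
  shows "1 \<le> num_stack_sortable t n"
proof -
  have "card (codes t 0 (n + 0)) \<le> card (codes t (n + 0) 0)"
    by (rule card_codes_shift[OF assms])
  then show ?thesis using card_codes_le_num_stack_sortable[of t n] by simp
qed

theorem theorem4:
  fixes t :: nat
  assumes "t \<ge> 1"
  shows "\<exists>L::real. (\<lambda>n. root n (real (num_stack_sortable t n))) \<longlonglongrightarrow> L
           \<and> L \<ge> (sqrt (real t) + 1)\<^sup>2"
proof -
  define a where "a n = real (num_stack_sortable t n)" for n
  have a1: "a n \<ge> 1" for n using num_stack_sortable_pos[OF assms, of n] by (simp add: a_def)
  have a0: "a n > 0" for n using a1[of n] by simp
  have "convergent (\<lambda>n. ln (a n) / n)"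
  proof (rule fekete_superadditive[where C = "real t * ln 4"])
    fix m n
    have "a m * a n \<le> a (m + n)"
      using num_stack_sortable_supermult[of t m n] unfolding a_def by (simp flip: of_nat_mult)
    then show "ln (a m) + ln (a n) \<le> ln (a (m + n))"
      using a0 by (simp flip: ln_mult_pos)
    show "0 \<le> ln (a n)" using a1 by simp
    have "a n \<le> real (4 ^ (t * n))"
      using num_stack_sortable_upper[of t n] unfolding a_def of_nat_le_iff .
    then have "ln (a n) \<le> ln (4 ^ (t * n))" using a0 by simp
    then show "ln (a n) \<le> (real t * ln 4) * n" by (simp add: ln_realpow mult_ac)
  qed
  then obtain l where l: "(\<lambda>n. ln (a n) / n) \<longlonglongrightarrow> l" by (auto simp: convergent_def)
  have lim: "(\<lambda>n. root n (a n)) \<longlonglongrightarrow> exp l"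
  proof (rule Lim_transform_eventually)
    show "(\<lambda>n. exp (ln (a n) / n)) \<longlonglongrightarrow> exp l" using l by (intro tendsto_intros)
    show "\<forall>\<^sub>F n in sequentially. exp (ln (a n) / n) = root n (a n)"
      using eventually_gt_at_top[of 0]
      by eventually_elim (simp add: root_powr_inverse powr_def less_imp_le[OF a0] less_imp_neq[OF a0, symmetric] divide_inverse mult.commute)
  qed
  have ge: "s\<^sup>2 \<le> exp l" if s: "sqrt t < s" "s < sqrt t + 1" for s
  proof -
    obtain c where c: "c > 0" "\<And>m. c * (s\<^sup>2) ^ m \<le> card (codes t (t + m) 0)"
      using card_codes_growth[OF assms s] by auto
    have "s > 0" using s by (smt (verit) real_sqrt_ge_zero of_nat_0_le_iff)
    \<comment> \<open>The division absorbs the \<open>t\<close> initial steps; the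
      \<open>n\<close>-th root of \<open>c'\<close> tends to 1.\<close>
    define c' where "c' = c / (s\<^sup>2) ^ t"
    have "c' > 0" using c \<open>s > 0\<close> by (simp add: c'_def)
    have "c' * (s\<^sup>2) ^ n \<le> a n" if "n \<ge> t" for n
    proof -
      have "c' * (s\<^sup>2) ^ n = c * (s\<^sup>2) ^ (n - t)"
        using that \<open>s > 0\<close> by (simp add: c'_def power_diff)
      also have "\<dots> \<le> card (codes t n 0)" using c(2)[of "n - t"] that by simp
      also have "\<dots> \<le> a n" using card_codes_le_num_stack_sortable[of t n] by (simp add: a_def)
      finally show ?thesis .
    qed
    then have "root n c' * s\<^sup>2 \<le> root n (a n)" if "n \<ge> max 1 t" for n
    proof -
      have "root n (c' * (s\<^sup>2) ^ n) \<le> root n (a n)"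
        using that \<open>\<And>n. n \<ge> t \<Longrightarrow> c' * (s\<^sup>2) ^ n \<le> a n\<close> by simp
      then show ?thesis using that by (simp add: real_root_mult real_root_power_cancel)
    qed
    then have "\<forall>\<^sub>F n in sequentially. root n c' * s\<^sup>2 \<le> root n (a n)"
      using eventually_ge_at_top by (rule eventually_mono[rotated])
    moreover have "(\<lambda>n. root n c' * s\<^sup>2) \<longlonglongrightarrow> 1 * s\<^sup>2"
      using LIMSEQ_root_const[OF \<open>c' > 0\<close>] by (intro tendsto_intros)
    ultimately show ?thesis using lim by (intro tendsto_le[OF _ lim]) auto
  qed
  \<comment> \<open>Here \<open>s\<close> approaches the critical value from below.\<close>
  have "sqrt t + 1 \<le> sqrt (exp l)"
  proof (rule dense_le_bounded[of "sqrt t"])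
    fix s assume "sqrt t < s" "s < sqrt t + 1"
    then show "s \<le> sqrt (exp l)" using ge[of s] by (simp add: real_le_rsqrt)
  qed simp
  then have "(sqrt t + 1)\<^sup>2 \<le> exp l"
    by (smt (verit) real_sqrt_ge_zero of_nat_0_le_iff power_mono real_sqrt_pow2 exp_ge_zero)
  then show ?thesis using lim unfolding a_def by blast
qed

end
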